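(* Let $A\in \mathbb{R}^{m\times n}$ be such that $e=(1,1,\dots,1)^{t}\in \mathcal{R}(A)$ and $A^{\dagger}\geq 0$. Let $A=P_{1}-R_{1}+S_{1}$ be a weak regular proper double splitting of $A$, and let $A=P_{2}-R_{2}+S_{2}$ be a regular proper double splitting of $A$ such that $P_{2}^{\dagger}$ has no zero row and $P_{2}P_{2}^{\dagger}\geq 0$. Define $$W_{1}=\begin{pmatrix} P_{1}^{\dagger}R_{1} & -P_{1}^{\dagger}S_{1}\\ I & 0\end{pmatrix},\qquad W_{2}=\begin{pmatrix} P_{2}^{\dagger}R_{2} & -P_{2}^{\dagger}S_{2}\\ I & 0\end{pmatrix}\in\mathbb{R}^{2n\times 2n},$$ where $I$ is the $n\times n$ identity matrix. If $P_{1}^{\dagger}\geq P_{2}^{\dagger}$ and at least one of the conditions (i) $P_{1}^{\dagger}R_{1}\geq P_{2}^{\dagger}R_{2}$, (ii) $P_{1}^{\dagger}S_{1}\geq P_{2}^{\dagger}S_{2}$ holds, then $\rho(W_{1})\leq \rho(W_{2})< 1$.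
   Context: $A^{\dagger}$ denotes the Moore–Penrose inverse of $A$ and $\mathcal{R}(A)$ its range. For real matrices, $B\geq 0$ means all entries of $B$ are nonnegative, and $B\geq C$ means $B-C\geq 0$. $\rho(\cdot)$ denotes the spectral radius. For $A\in\mathbb{R}^{m\times n}$, a decomposition $A=P-R+S$ with $P,R,S\in\mathbb{R}^{m\times n}$ is a proper double splitting if $\mathcal{R}(A)=\mathcal{R}(P)$ and $\mathcal{N}(A)=\mathcal{N}(P)$. A proper double splitting is called regular if $P^{\dagger}\geq 0$, $R\geq 0$ and $-S\geq 0$; it is called weak regular if $P^{\dagger}\geq 0$, $P^{\dagger}R\geq 0$ and $-P^{\dagger}S\geq 0$. *)

theory Defs
  imports "Jordan_Normal_Form.Matrix" "Jordan_Normal_Form.Spectral_Radius"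
begin

definition is_mp_inverse :: "real mat \<Rightarrow> real mat \<Rightarrow> bool" where
  "is_mp_inverse A X \<longleftrightarrow> X \<in> carrier_mat (dim_col A) (dim_row A) \<and>
     A * X * A = A \<and> X * A * X = X \<and>
     transpose_mat (A * X) = A * X \<and> transpose_mat (X * A) = X * A"

definition mp_inverse :: "real mat \<Rightarrow> real mat" where
  "mp_inverse A = (THE X. is_mp_inverse A X)"

definition range_mat :: "real mat \<Rightarrow> real vec set" where
  "range_mat A = {A *\<^sub>v x | x. x \<in> carrier_vec (dim_col A)}"

definition null_mat :: "real mat \<Rightarrow> real vec set" where
  "null_mat A = {x \<in> carrier_vec (dim_col A). A *\<^sub>v x = 0\<^sub>v (dim_row A)}"

definition nonneg_mat :: "real mat \<Rightarrow> bool" where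
  "nonneg_mat B \<longleftrightarrow> (\<forall>i<dim_row B. \<forall>j<dim_col B. B $$ (i,j) \<ge> 0)"

definition mat_ge :: "real mat \<Rightarrow> real mat \<Rightarrow> bool" where
  "mat_ge B C \<longleftrightarrow> dim_row B = dim_row C \<and> dim_col B = dim_col C \<and> nonneg_mat (B - C)"

definition proper_double_splitting :: "real mat \<Rightarrow> real mat \<Rightarrow> real mat \<Rightarrow> real mat \<Rightarrow> bool" where
  "proper_double_splitting A P R S \<longleftrightarrow>
     P \<in> carrier_mat (dim_row A) (dim_col A) \<and> R \<in> carrier_mat (dim_row A) (dim_col A) \<and>
     S \<in> carrier_mat (dim_row A) (dim_col A) \<and>
     A = P - R + S \<and> range_mat A = range_mat P \<and> null_mat A = null_mat P"

definition regular_pds :: "real mat \<Rightarrow> real mat \<Rightarrow> real mat \<Rightarrow> real mat \<Rightarrow> bool" where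
  "regular_pds A P R S \<longleftrightarrow> proper_double_splitting A P R S \<and>
     nonneg_mat (mp_inverse P) \<and> nonneg_mat R \<and> nonneg_mat (- S)"

definition weak_regular_pds :: "real mat \<Rightarrow> real mat \<Rightarrow> real mat \<Rightarrow> real mat \<Rightarrow> bool" where
  "weak_regular_pds A P R S \<longleftrightarrow> proper_double_splitting A P R S \<and>
     nonneg_mat (mp_inverse P) \<and> nonneg_mat (mp_inverse P * R) \<and> nonneg_mat (- (mp_inverse P * S))"

definition iter_mat :: "nat \<Rightarrow> real mat \<Rightarrow> real mat \<Rightarrow> real mat \<Rightarrow> real mat" where
  "iter_mat n P R S = four_block_mat (mp_inverse P * R) (- (mp_inverse P * S)) (1\<^sub>m n) (0\<^sub>m n n)"

definition rho :: "real mat \<Rightarrow> real" where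
  "rho W = spectral_radius (map_mat complex_of_real W)"

end

theory Submission
  imports Defs
begin

text \<open>
  With \<open>x = A\<^sup>\<dagger>e\<close> one has \<open>x - P\<^sub>2\<^sup>\<dagger>(R\<^sub>2 - S\<^sub>2)x = P\<^sub>2\<^sup>\<dagger>e > 0\<close>, so \<open>(x, x/l)\<close> for \<open>l\<close> slightly below 1
  is a positive vector with \<open>W\<^sub>2 z \<le> l z\<close>, whence \<open>\<rho>(W\<^sub>2) < 1\<close>.

  For the comparison, a Perron vector of \<open>W\<^sub>2\<close> need not be positive. Instead take any \<open>l\<close> with
  \<open>\<rho>(W\<^sub>2) < l < 1\<close> and solve \<open>(l - W\<^sub>2) z = (P\<^sub>2\<^sup>\<dagger>e, 0)\<close>. The solution is \<open>z = (x, x/l)\<close> with \<open>x > 0\<close>, and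
  \<open>P\<^sub>2P\<^sub>2\<^sup>\<dagger> \<ge> 0\<close> yields \<open>Ax \<ge> 0\<close>. As \<open>P\<^sub>i\<^sup>\<dagger>(R\<^sub>i - S\<^sub>i) = A\<^sup>\<dagger>A - P\<^sub>i\<^sup>\<dagger>A\<close>, the inequality \<open>P\<^sub>1\<^sup>\<dagger>Ax \<ge> P\<^sub>2\<^sup>\<dagger>Ax\<close>
  together with (i) or (ii) gives \<open>W\<^sub>1 z \<le> l z\<close>, hence \<open>\<rho>(W\<^sub>1) \<le> l\<close>; then let \<open>l\<close> tend to \<open>\<rho>(W\<^sub>2)\<close>.
\<close>

section \<open>The Moore--Penrose inverse\<close>

text \<open>Inserting \<open>A = A * Y * A\<close> gives \<open>A * X = (A * Y) * (A * X)\<close>;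
  transposing the symmetric factors reverses their order and collapses the product to
  \<open>A * Y\<close>. The same trick gives \<open>X * A = Y * A\<close>, and then
  \<open>X = X * A * X\<close> can be rewritten into \<open>Y\<close>.\<close>

lemma penrose_inverse_unique:
  assumes X: "is_mp_inverse A X" and Y: "is_mp_inverse A Y"
  shows "X = Y"
proof -
  define m n where "m = dim_row A" and "n = dim_col A"
  have A: "A \<in> carrier_mat m n" by (simp add: m_def n_def)
  have Xc: "X \<in> carrier_mat n m" and Yc: "Y \<in> carrier_mat n m"
    using X Y by (auto simp: is_mp_inverse_def m_def n_def)
  have x: "A * X * A = A" "X * A * X = X" "(A * X)\<^sup>T = A * X" "(X * A)\<^sup>T = X * A"
    and y: "A * Y * A = A" "Y * A * Y = Y" "(A * Y)\<^sup>T = A * Y" "(Y * A)\<^sup>T = Y * A"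
    using X Y by (auto simp: is_mp_inverse_def)
  have AX: "A * X \<in> carrier_mat m m" and AY: "A * Y \<in> carrier_mat m m"
    and XA: "X * A \<in> carrier_mat n n" and YA: "Y * A \<in> carrier_mat n n"
    using A Xc Yc by auto
  have "A * X = (A * Y * A) * X" using y by simp
  also have "\<dots> = (A * Y) * (A * X)" by (simp only: assoc_mult_mat[OF AY A Xc])
  finally have "(A * X)\<^sup>T = (A * X)\<^sup>T * (A * Y)\<^sup>T" using transpose_mult[OF AY AX] by simp
  then have "A * X = (A * X) * (A * Y)" using x y by simp
  also have "\<dots> = (A * X * A) * Y" by (simp only: assoc_mult_mat[OF AX A Yc])
  finally have e1: "A * X = A * Y" using x by simp
  have "X * A = X * (A * Y * A)" using y by simp
  also have "\<dots> = (X * A) * (Y * A)"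
    by (simp only: assoc_mult_mat[OF A Yc A] assoc_mult_mat[OF Xc A YA])
  finally have "(X * A)\<^sup>T = (Y * A)\<^sup>T * (X * A)\<^sup>T" using transpose_mult[OF XA YA] by simp
  then have "X * A = (Y * A) * (X * A)" using x y by simp
  also have "\<dots> = Y * (A * X * A)"
    by (simp only: assoc_mult_mat[OF A Xc A] assoc_mult_mat[OF Yc A XA])
  finally have e2: "X * A = Y * A" using x by simp
  have "X = X * (A * X)" using x by (simp only: assoc_mult_mat[OF Xc A Xc])
  also have "\<dots> = (X * A) * Y" by (simp only: e1 assoc_mult_mat[OF Xc A Yc])
  also have "\<dots> = Y" using e2 y by simp
  finally show ?thesis .
qed

section \<open>Existence of the inverse through orthogonal projections\<close>

lemma mult_mat_unit_vec:
  fixes A :: "'a :: semiring_1 mat"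
  assumes "A \<in> carrier_mat m n" and "j < n"
  shows "A *\<^sub>v unit_vec n j = col A j"
  using assms by (intro eq_vecI) auto

lemma mat_eqI_mult_vec:
  fixes A B :: "real mat"
  assumes A: "A \<in> carrier_mat m n" and B: "B \<in> carrier_mat m n"
    and eq: "\<And>x. x \<in> carrier_vec n \<Longrightarrow> A *\<^sub>v x = B *\<^sub>v x"
  shows "A = B"
proof (rule mat_col_eqI)
  fix i assume i: "i < dim_col B"
  have "A *\<^sub>v unit_vec n i = col A i" "B *\<^sub>v unit_vec n i = col B i"
    using A B i by (auto simp: mult_mat_unit_vec)
  then show "col A i = col B i" using eq[of "unit_vec n i"] by simp
qed (use A B in auto)

lemma vec_norm_sq_eq_0:
  fixes c :: "real vec" assumes "c \<in> carrier_vec m" "c \<bullet> c = 0" shows "c = 0\<^sub>v m"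
proof (rule eq_vecI)
  fix i assume i: "i < dim_vec (0\<^sub>v m :: real vec)"
  have "(\<Sum>i = 0..<dim_vec c. c $ i * c $ i) = 0" using assms by (simp add: scalar_prod_def)
  then show "c $ i = 0\<^sub>v m $ i" using i assms(1) by (subst (asm) sum_nonneg_eq_0_iff) auto
qed (use assms in auto)

text \<open>Gram-Schmidt phrased with projections: each new vector adds to \<open>Q\<close> the
  rank-one projection onto its residual. \<open>V\<close> stays fixed while \<open>vs\<close> grows,
  so that having image in \<open>V\<close> is an invariant of the induction.\<close>

lemma orthogonal_projection_exists:
  fixes vs :: "real vec list"
  assumes V: "V \<subseteq> carrier_vec m"
    and V0: "0\<^sub>v m \<in> V"
    and Vadd: "\<And>x y. x \<in> V \<Longrightarrow> y \<in> V \<Longrightarrow> x + y \<in> V"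
    and Vsm: "\<And>a x. x \<in> V \<Longrightarrow> a \<cdot>\<^sub>v x \<in> V"
    and vs: "set vs \<subseteq> V"
  shows "\<exists>Q \<in> carrier_mat m m. Q\<^sup>T = Q \<and> (\<forall>v \<in> set vs. Q *\<^sub>v v = v) \<and>
    (\<forall>x \<in> carrier_vec m. Q *\<^sub>v x \<in> V \<and> Q *\<^sub>v (Q *\<^sub>v x) = Q *\<^sub>v x)"
  using vs
proof (induction vs)
  case Nil
  have "0\<^sub>m m m *\<^sub>v x = 0\<^sub>v m" if "x \<in> carrier_vec m" for x :: "real vec"
    using that by (intro eq_vecI) auto
  then show ?case
    by (intro bexI[of _ "0\<^sub>m m m"]) (auto simp: V0)
next
  case (Cons a vs)
  then obtain Q where Q: "Q \<in> carrier_mat m m" and sym: "Q\<^sup>T = Q"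
    and fixd: "\<And>v. v \<in> set vs \<Longrightarrow> Q *\<^sub>v v = v"
    and inV: "\<And>x. x \<in> carrier_vec m \<Longrightarrow> Q *\<^sub>v x \<in> V"
    and idem: "\<And>x. x \<in> carrier_vec m \<Longrightarrow> Q *\<^sub>v (Q *\<^sub>v x) = Q *\<^sub>v x" by auto
  have a: "a \<in> carrier_vec m" "a \<in> V" using Cons.prems V by auto
  have Qc[simp]: "Q *\<^sub>v x \<in> carrier_vec m" if "x \<in> carrier_vec m" for x using Q that by simp
  have symQ: "(Q *\<^sub>v y) \<bullet> x = y \<bullet> (Q *\<^sub>v x)" if "x \<in> carrier_vec m" "y \<in> carrier_vec m" for x y
    using transpose_vec_mult_scalar[OF Q that] sym by simp
  \<comment> \<open>The residual of \<open>a\<close>: idempotence of \<open>Q\<close> makes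
    \<open>Q\<close> annihilate it, and symmetry of \<open>Q\<close> then makes it orthogonal to
    every vector that \<open>Q\<close> fixes.\<close>
  define c where "c = a - Q *\<^sub>v a"
  have c: "c \<in> carrier_vec m" using a by (simp add: c_def)
  have cV: "c \<in> V"
  proof -
    have "c = a + (- 1) \<cdot>\<^sub>v (Q *\<^sub>v a)" using a Q by (intro eq_vecI) (auto simp: c_def)
    then show ?thesis using Vadd[OF a(2) Vsm[OF inV[OF a(1)]]] by simp
  qed
  have Qc0: "Q *\<^sub>v c = 0\<^sub>v m"
    using a Q by (simp add: c_def mult_minus_distrib_mat_vec idem)
  have cv: "c \<bullet> v = 0" if v: "v \<in> carrier_vec m" "Q *\<^sub>v v = v" for v
  proof -
    have "c \<bullet> v = c \<bullet> (Q *\<^sub>v v)" using v by simp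
    also have "\<dots> = (Q *\<^sub>v c) \<bullet> v" using symQ[OF v(1) c] by simp
    also have "\<dots> = 0" using Qc0 v by simp
    finally show ?thesis .
  qed
  show ?case
  proof (cases "c = 0\<^sub>v m")
    case True
    have "Q *\<^sub>v a = a"
    proof (rule eq_vecI)
      fix i assume i: "i < dim_vec a"
      then have "c $ i = 0" using True a by simp
      then show "(Q *\<^sub>v a) $ i = a $ i" using i a Q by (simp add: c_def)
    qed (use Q a in auto)
    then show ?thesis using Q sym fixd inV idem by (intro bexI[of _ Q]) auto
  next
    case False
    define k where "k = c \<bullet> c"
    have k: "k \<noteq> 0" using vec_norm_sq_eq_0[OF c] False by (auto simp: k_def)
    \<comment> \<open>The orthogonal projection onto the line spanned by \<open>c\<close>; the
      divisor \<open>k\<close> is the squared norm of \<open>c\<close>.\<close>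
    define D where "D = mat m m (\<lambda>(i,j). c $ i * c $ j / k)"
    have D: "D \<in> carrier_mat m m" by (simp add: D_def)
    have Dx: "D *\<^sub>v x = ((c \<bullet> x) / k) \<cdot>\<^sub>v c" if "x \<in> carrier_vec m" for x
    proof (rule eq_vecI)
      fix i assume i: "i < dim_vec (((c \<bullet> x) / k) \<cdot>\<^sub>v c)"
      have "(D *\<^sub>v x) $ i = (\<Sum>j = 0..<m. c $ i * c $ j / k * x $ j)"
        using i c that by (simp add: D_def scalar_prod_def)
      also have "\<dots> = (\<Sum>j = 0..<m. c $ j * x $ j) / k * c $ i"
        by (simp add: sum_distrib_left sum_distrib_right sum_divide_distrib mult_ac)
      finally show "(D *\<^sub>v x) $ i = (((c \<bullet> x) / k) \<cdot>\<^sub>v c) $ i"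
        using i c that by (simp add: scalar_prod_def)
    qed (use D c in auto)
    have DV: "D *\<^sub>v x \<in> V" if "x \<in> carrier_vec m" for x using Dx[OF that] Vsm[OF cV] by simp
    have QDx: "(Q + D) *\<^sub>v x = Q *\<^sub>v x + D *\<^sub>v x" if "x \<in> carrier_vec m" for x
      using add_mult_distrib_mat_vec[OF Q D that] .
    have QD0: "Q *\<^sub>v (D *\<^sub>v x) = 0\<^sub>v m" if "x \<in> carrier_vec m" for x
      using Dx[OF that] mult_mat_vec[OF Q c] Qc0 by (auto intro!: eq_vecI)
    have DQ0: "D *\<^sub>v (Q *\<^sub>v x) = 0\<^sub>v m" if x: "x \<in> carrier_vec m" for x
      using Dx[of "Q *\<^sub>v x"] cv[of "Q *\<^sub>v x"] idem[OF x] x c by (auto intro!: eq_vecI)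
    have DD: "D *\<^sub>v (D *\<^sub>v x) = D *\<^sub>v x" if x: "x \<in> carrier_vec m" for x
      using Dx[of "D *\<^sub>v x"] Dx[OF x] c k by (simp add: k_def[symmetric])
    have "D\<^sup>T = D" by (intro eq_matI) (auto simp: D_def)
    then have s: "(Q + D)\<^sup>T = Q + D" using transpose_add[OF Q D] sym by simp
    have fa: "(Q + D) *\<^sub>v a = a"
    proof -
      \<comment> \<open>The summands of \<open>a = c + Q *\<^sub>v a\<close> are orthogonal, so
        \<open>D\<close> maps \<open>a\<close> to \<open>c\<close> and \<open>Q\<close> supplies the
        rest.\<close>
      have "c \<bullet> (Q *\<^sub>v a) = 0" using cv idem[OF a(1)] a by simp
      then have "c \<bullet> a = k"
        using scalar_prod_minus_distrib[OF c a(1) Qc[OF a(1)]] by (simp add: k_def c_def[symmetric])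
      then have "D *\<^sub>v a = c" using Dx[OF a(1)] k by simp
      then show ?thesis using QDx[OF a(1)] a Q by (intro eq_vecI) (auto simp: c_def)
    qed
    have fv: "(Q + D) *\<^sub>v v = v" if "v \<in> set vs" for v
    proof -
      have v: "v \<in> carrier_vec m" using that Cons.prems V by auto
      show ?thesis using QDx[OF v] Dx[OF v] cv[OF v fixd[OF that]] fixd[OF that] c v
        by (auto intro!: eq_vecI)
    qed
    \<comment> \<open>The cross terms vanish: \<open>D\<close> maps into the line of
      \<open>c\<close>, which \<open>Q\<close> kills, and \<open>Q\<close> maps into vectors
      orthogonal to \<open>c\<close>.\<close>
    have id2: "(Q + D) *\<^sub>v ((Q + D) *\<^sub>v x) = (Q + D) *\<^sub>v x" if x: "x \<in> carrier_vec m" for x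
    proof -
      have Dc: "D *\<^sub>v x \<in> carrier_vec m" using D x by simp
      have "(Q + D) *\<^sub>v ((Q + D) *\<^sub>v x) = (Q + D) *\<^sub>v (Q *\<^sub>v x) + (Q + D) *\<^sub>v (D *\<^sub>v x)"
        using QDx[OF x] mult_add_distrib_mat_vec[of "Q + D" m m "Q *\<^sub>v x" "D *\<^sub>v x"] Q D x Dc by simp
      also have "\<dots> = (Q *\<^sub>v x + 0\<^sub>v m) + (0\<^sub>v m + D *\<^sub>v x)"
        using QDx[OF Qc[OF x]] QDx[OF Dc] idem[OF x] QD0[OF x] DQ0[OF x] DD[OF x] by simp
      also have "\<dots> = (Q + D) *\<^sub>v x" using QDx[OF x] Dc Qc[OF x] by simp
      finally show ?thesis .
    qed
    have "(Q + D) *\<^sub>v x \<in> V" if x: "x \<in> carrier_vec m" for x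
      using QDx[OF x] Vadd[OF inV[OF x] DV[OF x]] by simp
    then show ?thesis using Q D s fa fv id2 by (intro bexI[of _ "Q + D"]) auto
  qed
qed

text \<open>Let \<open>Q\<close> be a symmetric matrix that fixes the columns of \<open>A\<close>
  and has its image in the range of \<open>A\<close>. Each column of \<open>Q\<close> is then
  \<open>A\<close> times some vector; collecting these vectors as the columns of \<open>X\<close>
  gives \<open>A * X = Q\<close>.\<close>

lemma least_squares_inverse_exists:
  fixes A :: "real mat"
  assumes A: "A \<in> carrier_mat m n"
  shows "\<exists>X \<in> carrier_mat n m. A * X * A = A \<and> (A * X)\<^sup>T = A * X"
proof -
  have V: "range_mat A \<subseteq> carrier_vec m" using A by (auto simp: range_mat_def)
  have V0: "0\<^sub>v m \<in> range_mat A"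
    using A by (auto simp: range_mat_def intro!: exI[of _ "0\<^sub>v n"])
  have Vadd: "x + y \<in> range_mat A" if "x \<in> range_mat A" and "y \<in> range_mat A" for x y
  proof -
    obtain u w where "u \<in> carrier_vec n" "w \<in> carrier_vec n" "x = A *\<^sub>v u" "y = A *\<^sub>v w"
      using \<open>x \<in> range_mat A\<close> \<open>y \<in> range_mat A\<close> A by (auto simp: range_mat_def)
    then show ?thesis
      using A mult_add_distrib_mat_vec[OF A, of u w] by (auto simp: range_mat_def intro!: exI[of _ "u + w"])
  qed
  have Vsm: "a \<cdot>\<^sub>v x \<in> range_mat A" if "x \<in> range_mat A" for a x
  proof -
    obtain u where "u \<in> carrier_vec n" "x = A *\<^sub>v u"
      using \<open>x \<in> range_mat A\<close> A by (auto simp: range_mat_def)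
    then show ?thesis
      using A mult_mat_vec[OF A, of u a] by (auto simp: range_mat_def intro!: exI[of _ "a \<cdot>\<^sub>v u"])
  qed
  have unitA: "col A i = A *\<^sub>v unit_vec n i" if "i < n" for i
    using mult_mat_unit_vec[OF A that] by simp
  have "set (cols A) \<subseteq> range_mat A"
    using A unitA by (auto simp: cols_def range_mat_def)
  from orthogonal_projection_exists[OF V V0 Vadd Vsm this]
  obtain Q where Q: "Q \<in> carrier_mat m m" and sym: "Q\<^sup>T = Q"
    and fixd: "\<forall>v \<in> set (cols A). Q *\<^sub>v v = v"
    and rng: "\<And>x. x \<in> carrier_vec m \<Longrightarrow> Q *\<^sub>v x \<in> range_mat A" by blast
  have QA: "Q * A = A"
  proof (rule mat_col_eqI)
    fix j assume "j < dim_col A"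
    then have "j < n" and "col A j \<in> set (cols A)" using A by (auto simp: cols_def)
    then show "col (Q * A) j = col A j" using col_mult2[OF Q A] fixd by metis
  qed (use Q A in auto)
  have "\<exists>y \<in> carrier_vec n. A *\<^sub>v y = col Q j" if "j < m" for j
  proof -
    have "Q *\<^sub>v unit_vec m j = col Q j" using mult_mat_unit_vec[OF Q that] by simp
    then show ?thesis using rng[of "unit_vec m j"] A by (auto simp: range_mat_def)
  qed
  then obtain g where g: "\<And>j. j < m \<Longrightarrow> g j \<in> carrier_vec n" "\<And>j. j < m \<Longrightarrow> A *\<^sub>v g j = col Q j"
    by metis
  define X where "X = mat_of_cols n (map g [0..<m])"
  have X: "X \<in> carrier_mat n m" by (simp add: X_def mat_of_cols_carrier(1)[of n "map g [0..<m]", simplified])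
  have "A * X = Q"
  proof (rule mat_col_eqI)
    fix j assume "j < dim_col Q"
    then have j: "j < m" using Q by simp
    have "col X j = g j" using j g(1) by (simp add: X_def)
    then show "col (A * X) j = col Q j" using col_mult2[OF A X j] g(2)[OF j] by simp
  qed (use A X Q in auto)
  then show ?thesis using X QA sym by (intro bexI[of _ X]) auto
qed

text \<open>The preceding lemma for \<open>A\<close> gives \<open>X\<close> with
  \<open>A * X\<close> symmetric; for the transpose of \<open>A\<close> it gives, after transposing,
  \<open>Z\<close> with \<open>Z * A\<close> symmetric. The product \<open>U = Z * A * X\<close>
  inherits both symmetries, since \<open>A * U = A * X\<close> and
  \<open>U * A = Z * A\<close>.\<close>

lemma penrose_inverse_exists:
  "\<exists>X. is_mp_inverse A X"
proof -
  define m n where "m = dim_row A" and "n = dim_col A"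
  have A: "A \<in> carrier_mat m n" by (simp add: m_def n_def)
  obtain X where X: "X \<in> carrier_mat n m" "A * X * A = A" "(A * X)\<^sup>T = A * X"
    using least_squares_inverse_exists[OF A] by blast
  have At: "A\<^sup>T \<in> carrier_mat n m" using A by simp
  obtain Y where Y: "Y \<in> carrier_mat m n" "A\<^sup>T * Y * A\<^sup>T = A\<^sup>T" "(A\<^sup>T * Y)\<^sup>T = A\<^sup>T * Y"
    using least_squares_inverse_exists[OF At] by blast
  define Z where "Z = Y\<^sup>T"
  have Z: "Z \<in> carrier_mat n m" using Y by (simp add: Z_def)
  have ZA: "Z * A = A\<^sup>T * Y" using transpose_mult[OF At Y(1)] Y by (simp add: Z_def)
  have ZAs: "(Z * A)\<^sup>T = Z * A" using ZA Y by simp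
  have ZAc: "Z * A \<in> carrier_mat n n" and AZc: "A * Z \<in> carrier_mat m m" and AXc: "A * X \<in> carrier_mat m m"
    using Z A X by auto
  have "(A\<^sup>T * Y * A\<^sup>T)\<^sup>T = A * (Z * A)"
    using transpose_mult[of "A\<^sup>T * Y" n n "A\<^sup>T" m] At Y by (simp add: ZA)
  then have AZA: "A * (Z * A) = A" using Y by simp
  define U where "U = Z * A * X"
  have U: "U \<in> carrier_mat n m" using ZAc X by (simp add: U_def)
  have AU: "A * U = A * X"
  proof -
    have "A * U = A * (Z * A) * X" using A ZAc X assoc_mult_mat[OF A ZAc X(1)] by (simp add: U_def)
    then show ?thesis using AZA by simp
  qed
  have UA: "U * A = Z * A"
  proof -
    have "U * A = Z * (A * X) * A" using assoc_mult_mat[OF Z A X(1)] by (simp add: U_def)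
    also have "\<dots> = Z * (A * X * A)" using assoc_mult_mat[OF Z AXc A] .
    finally show ?thesis using X by simp
  qed
  have "U * A * U = Z * (A * U)" using UA assoc_mult_mat[OF Z A U] by simp
  also have "\<dots> = U" using AU assoc_mult_mat[OF Z A X(1)] by (simp add: U_def)
  finally have "U * A * U = U" .
  then have "is_mp_inverse A U"
    using U AU UA X ZAs by (auto simp: is_mp_inverse_def m_def n_def)
  then show ?thesis ..
qed

text \<open>Makes the definite description in \<open>mp_inverse\<close> usable.\<close>

lemma is_mp_inverse_mp_inverse: "is_mp_inverse A (mp_inverse A)"
  unfolding mp_inverse_def
  by (rule theI') (use penrose_inverse_exists penrose_inverse_unique in blast)

lemma mp_inverse:
  assumes "A \<in> carrier_mat m n"
  shows "mp_inverse A \<in> carrier_mat n m"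
    and "A * mp_inverse A * A = A"
    and "mp_inverse A * A * mp_inverse A = mp_inverse A"
    and "(A * mp_inverse A)\<^sup>T = A * mp_inverse A"
    and "(mp_inverse A * A)\<^sup>T = mp_inverse A * A"
  using is_mp_inverse_mp_inverse[of A] assms by (auto simp: is_mp_inverse_def)

text \<open>Both sides are symmetric and each acts as the identity on the common range, so
  \<open>E * F = F\<close> and \<open>F * E = E\<close>; transposing the second equation gives
  \<open>E = E * F\<close>.\<close>

lemma mp_inverse_range_eq:
  assumes A: "A \<in> carrier_mat m n" and P: "P \<in> carrier_mat m n"
    and r: "range_mat A = range_mat P"
  shows "A * mp_inverse A = P * mp_inverse P"
proof -
  have key: "B * mp_inverse B * C = C"
    if B: "B \<in> carrier_mat m n" and C: "C \<in> carrier_mat m n" and r: "range_mat C \<subseteq> range_mat B"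
    for B C :: "real mat"
  proof (rule mat_eqI_mult_vec)
    note b = mp_inverse[OF B]
    show c: "B * mp_inverse B * C \<in> carrier_mat m n" using B C b(1) by auto
    fix x :: "real vec" assume x: "x \<in> carrier_vec n"
    have "C *\<^sub>v x \<in> range_mat B" using r x C by (auto simp: range_mat_def)
    then obtain y where y: "y \<in> carrier_vec n" "C *\<^sub>v x = B *\<^sub>v y" using B by (auto simp: range_mat_def)
    have Bc: "B * mp_inverse B \<in> carrier_mat m m" using B b(1) by auto
    have "(B * mp_inverse B * C) *\<^sub>v x = (B * mp_inverse B) *\<^sub>v (B *\<^sub>v y)"
      using assoc_mult_mat_vec[OF Bc C x] y by simp
    also have "\<dots> = (B * mp_inverse B * B) *\<^sub>v y" using assoc_mult_mat_vec[OF Bc B y(1)] by simp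
    finally show "(B * mp_inverse B * C) *\<^sub>v x = C *\<^sub>v x" using b y by simp
  qed fact
  let ?E = "A * mp_inverse A" and ?F = "P * mp_inverse P"
  note a = mp_inverse[OF A] and p = mp_inverse[OF P]
  have E: "?E \<in> carrier_mat m m" and F: "?F \<in> carrier_mat m m" using A P a(1) p(1) by auto
  have EF: "?E * ?F = ?F" using key[OF A P] r assoc_mult_mat[OF E P p(1)] by simp
  have FE: "?F * ?E = ?E" using key[OF P A] r assoc_mult_mat[OF F A a(1)] by simp
  have "?E = ?E\<^sup>T" using a by simp
  also have "\<dots> = (?F * ?E)\<^sup>T" using FE by simp
  also have "\<dots> = ?E * ?F" using transpose_mult[OF F E] a p by simp
  finally show ?thesis using EF by simp
qed

text \<open>Dual to the range version: \<open>x\<close> and \<open>mp_inverse B * B\<close> applied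
  to \<open>x\<close> differ by a null vector of \<open>B\<close>, so a matrix \<open>C\<close> that
  kills the null space of \<open>B\<close> does not see the difference.\<close>

lemma mp_inverse_null_eq:
  assumes A: "A \<in> carrier_mat m n" and P: "P \<in> carrier_mat m n"
    and nl: "null_mat A = null_mat P"
  shows "mp_inverse A * A = mp_inverse P * P"
proof -
  have key: "C * (mp_inverse B * B) = C"
    if B: "B \<in> carrier_mat m n" and C: "C \<in> carrier_mat m n" and nl: "null_mat B \<subseteq> null_mat C"
    for B C :: "real mat"
  proof (rule mat_eqI_mult_vec)
    note b = mp_inverse[OF B]
    have Bc: "mp_inverse B * B \<in> carrier_mat n n" using B b(1) by auto
    show "C * (mp_inverse B * B) \<in> carrier_mat m n" using C Bc by auto
    fix x :: "real vec" assume x: "x \<in> carrier_vec n"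
    let ?y = "(mp_inverse B * B) *\<^sub>v x"
    have y: "?y \<in> carrier_vec n" using Bc x by simp
    have "B *\<^sub>v ?y = (B * (mp_inverse B * B)) *\<^sub>v x" using assoc_mult_mat_vec[OF B Bc x] by simp
    also have "B * (mp_inverse B * B) = B" using b assoc_mult_mat[OF B b(1) B] by simp
    finally have "B *\<^sub>v (x - ?y) = 0\<^sub>v m" using mult_minus_distrib_mat_vec[OF B x y] B x by simp
    then have "x - ?y \<in> null_mat B" using B x y by (auto simp: null_mat_def)
    then have "C *\<^sub>v (x - ?y) = 0\<^sub>v m" using nl C by (auto simp: null_mat_def)
    then have d: "C *\<^sub>v x - C *\<^sub>v ?y = 0\<^sub>v m" using mult_minus_distrib_mat_vec[OF C x y] by simp
    have "C *\<^sub>v ?y = C *\<^sub>v x"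
    proof (rule eq_vecI)
      fix i assume i: "i < dim_vec (C *\<^sub>v x)"
      then have "(C *\<^sub>v x - C *\<^sub>v ?y) $ i = 0" using d C by simp
      then show "(C *\<^sub>v ?y) $ i = (C *\<^sub>v x) $ i" using i by simp
    qed simp
    then show "(C * (mp_inverse B * B)) *\<^sub>v x = C *\<^sub>v x" using assoc_mult_mat_vec[OF C Bc x] by simp
  qed fact
  let ?E = "mp_inverse A * A" and ?F = "mp_inverse P * P"
  note a = mp_inverse[OF A] and p = mp_inverse[OF P]
  have E: "?E \<in> carrier_mat n n" and F: "?F \<in> carrier_mat n n" using A P a(1) p(1) by auto
  have EF: "?E * ?F = ?E" using key[OF P A] nl assoc_mult_mat[OF a(1) A F] by simp
  have FE: "?F * ?E = ?F" using key[OF A P] nl assoc_mult_mat[OF p(1) P E] by simp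
  have "?F = ?F\<^sup>T" using p by simp
  also have "\<dots> = (?F * ?E)\<^sup>T" using FE by simp
  also have "\<dots> = ?E * ?F" using transpose_mult[OF F E] a p by simp
  finally show ?thesis using EF by simp
qed

section \<open>Nonnegative matrices and the spectral radius\<close>

lemma nonneg_mult_vec_mono:
  fixes M :: "real mat"
  assumes M: "nonneg_mat M" "M \<in> carrier_mat nr nc"
    and x: "x \<in> carrier_vec nc" and y: "y \<in> carrier_vec nc" and le: "x \<le> y"
  shows "M *\<^sub>v x \<le> M *\<^sub>v y"
  using assms
  by (auto simp: less_eq_vec_def scalar_prod_def nonneg_mat_def intro!: sum_mono mult_left_mono)

lemma nonneg_mult_vec:
  fixes M :: "real mat"
  assumes "nonneg_mat M" "M \<in> carrier_mat nr nc" "x \<in> carrier_vec nc" "0\<^sub>v nc \<le> x"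
  shows "0\<^sub>v nr \<le> M *\<^sub>v x"
  using assms
  by (auto simp: less_eq_vec_def scalar_prod_def nonneg_mat_def intro!: sum_nonneg mult_nonneg_nonneg)

lemma nonneg_mat_mult_vec_index:
  fixes M :: "real mat"
  assumes "M \<in> carrier_mat nr nc" "x \<in> carrier_vec nc" "i < nr"
  shows "(M *\<^sub>v x) $ i = (\<Sum>j<nc. M $$ (i,j) * x $ j)"
  using assms by (auto simp: scalar_prod_def lessThan_atLeast0 intro!: sum.cong)

text \<open>The upper Collatz--Wielandt bound: compare an eigenvector \<open>u\<close> with \<open>z\<close> at an
  index maximising \<open>\<bar>u\<^sub>i\<bar> / z\<^sub>i\<close>.\<close>

lemma rho_le_of_supersolution:
  assumes W: "W \<in> carrier_mat N N" and N: "0 < N" and nn: "nonneg_mat W"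
    and z: "z \<in> carrier_vec N" and pos: "\<And>i. i < N \<Longrightarrow> 0 < z $ i"
    and sup: "W *\<^sub>v z \<le> l \<cdot>\<^sub>v z"
  shows "rho W \<le> l"
proof -
  let ?C = "map_mat complex_of_real W"
  have C: "?C \<in> carrier_mat N N" using W by simp
  obtain ev where ev: "ev \<in> spectrum ?C" "rho W = cmod ev"
    using spectral_radius_mem_max(1)[OF C N] by (auto simp: rho_def)
  then obtain u where u: "u \<in> carrier_vec N" "u \<noteq> 0\<^sub>v N" "?C *\<^sub>v u = ev \<cdot>\<^sub>v u"
    using W by (auto simp: spectrum_def eigenvalue_def eigenvector_def)
  define t where "t = Max ((\<lambda>i. cmod (u $ i) / z $ i) ` {..<N})"
  have "t \<in> (\<lambda>i. cmod (u $ i) / z $ i) ` {..<N}"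
    unfolding t_def using N by (intro Max_in) auto
  then obtain i where i: "i < N" "t = cmod (u $ i) / z $ i" by auto
  have t: "cmod (u $ j) \<le> t * z $ j" if "j < N" for j
  proof -
    have "cmod (u $ j) / z $ j \<le> t" unfolding t_def using that by (intro Max_ge) auto
    then show ?thesis using pos[OF that] by (simp add: field_simps)
  qed
  have tpos: "0 < t"
  proof -
    obtain j where j: "j < N" "u $ j \<noteq> 0" using u by (auto simp: vec_eq_iff)
    then have "0 < t * z $ j" using t[of j] by (smt (verit) zero_less_norm_iff)
    then show ?thesis using pos[OF j(1)] by (simp add: zero_less_mult_iff)
  qed
  have "cmod ev * cmod (u $ i) = cmod ((?C *\<^sub>v u) $ i)"
    using u i by (simp add: norm_mult)
  also have "(?C *\<^sub>v u) $ i = (\<Sum>j<N. of_real (W $$ (i,j)) * u $ j)"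
    using W u(1) i by (auto simp: scalar_prod_def lessThan_atLeast0 intro!: sum.cong)
  also have "cmod \<dots> \<le> (\<Sum>j<N. W $$ (i,j) * (t * z $ j))"
    using nn W i(1) t
    by (intro order_trans[OF norm_sum] sum_mono)
      (auto simp: norm_mult nonneg_mat_def intro!: mult_left_mono)
  also have "\<dots> = t * (W *\<^sub>v z) $ i"
    using nonneg_mat_mult_vec_index[OF W z i(1)] by (simp add: sum_distrib_left mult_ac)
  also have "\<dots> \<le> t * (l * z $ i)"
    using sup i z tpos by (intro mult_left_mono) (auto simp: less_eq_vec_def)
  \<comment> \<open>Equality holds because \<open>i\<close> attains the maximum; both sides thus
    carry the same positive factor, which cancels.\<close>
  also have "cmod (u $ i) = t * z $ i" using i pos[OF i(1)] by simp
  finally have "cmod ev * (t * z $ i) \<le> l * (t * z $ i)" by (simp add: mult_ac)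
  moreover have "0 < t * z $ i" using mult_pos_pos[OF tpos pos[OF i(1)]] .
  ultimately show ?thesis using ev by (simp add: mult_le_cancel_right)
qed

lemma rho_nonneg:
  assumes W: "W \<in> carrier_mat N N" and N: "0 < N"
  shows "0 \<le> rho W"
proof -
  have "map_mat complex_of_real W \<in> carrier_mat N N" using W by simp
  from spectral_radius_mem_max(1)[OF this N] show ?thesis by (auto simp: rho_def)
qed

section \<open>Growth of matrix powers and the nonnegative resolvent\<close>

lemma spectral_radius_smult_le:
  assumes A: "A \<in> carrier_mat N N" and N: "0 < N" and c: "c \<noteq> 0"
  shows "spectral_radius (c \<cdot>\<^sub>m A) \<le> cmod c * spectral_radius A"
proof -
  obtain ev where ev: "ev \<in> spectrum (c \<cdot>\<^sub>m A)" "spectral_radius (c \<cdot>\<^sub>m A) = cmod ev"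
    using spectral_radius_mem_max(1)[of "c \<cdot>\<^sub>m A" N] A N by auto
  then obtain u where u: "u \<in> carrier_vec N" "u \<noteq> 0\<^sub>v N" "(c \<cdot>\<^sub>m A) *\<^sub>v u = ev \<cdot>\<^sub>v u"
    using A by (auto simp: spectrum_def eigenvalue_def eigenvector_def)
  have "A *\<^sub>v u = (ev / c) \<cdot>\<^sub>v u"
  proof (rule eq_vecI)
    fix i assume "i < dim_vec ((ev / c) \<cdot>\<^sub>v u)"
    then have i: "i < N" using u by simp
    have "((c \<cdot>\<^sub>m A) *\<^sub>v u) $ i = c * (A *\<^sub>v u) $ i"
      using A u(1) i by (simp add: scalar_prod_def sum_distrib_left mult_ac)
    moreover have "((c \<cdot>\<^sub>m A) *\<^sub>v u) $ i = ev * u $ i"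
      unfolding u(3) using u(1) i by simp
    ultimately show "(A *\<^sub>v u) $ i = ((ev / c) \<cdot>\<^sub>v u) $ i"
      using u i c by (simp add: field_simps)
  qed (use A u in auto)
  then have "ev / c \<in> spectrum A"
    using A u by (auto simp: spectrum_def eigenvalue_def eigenvector_def)
  then have "cmod (ev / c) \<le> spectral_radius A"
    using spectral_radius_mem_max(2)[OF A N] by blast
  then show ?thesis using ev c by (simp add: norm_divide field_simps)
qed

lemma pow_smult_mat:
  fixes A :: "'a :: comm_ring_1 mat"
  assumes A: "A \<in> carrier_mat N N"
  shows "(c \<cdot>\<^sub>m A) ^\<^sub>m k = c ^ k \<cdot>\<^sub>m (A ^\<^sub>m k)"
proof (induction k)
  case (Suc k)
  have Ak: "A ^\<^sub>m k \<in> carrier_mat N N" using A by simp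
  show ?case using Suc A Ak mult_smult_assoc_mat[OF Ak A] mult_smult_distrib[of "c ^ k \<cdot>\<^sub>m A ^\<^sub>m k" N N A N c]
    by (auto intro!: eq_matI simp: mult_ac)
qed (use A in auto)

lemma pow_mat_Suc_left:
  fixes A :: "'a :: semiring_1 mat"
  assumes A: "A \<in> carrier_mat N N"
  shows "A ^\<^sub>m Suc k = A * A ^\<^sub>m k"
proof (induction k)
  case (Suc k)
  have "A ^\<^sub>m k \<in> carrier_mat N N" using A by simp
  then have "A * A ^\<^sub>m k * A = A * A ^\<^sub>m Suc k" using A by (simp add: assoc_mult_mat[OF A _ A])
  then show ?case using Suc by simp
qed (use A in auto)

text \<open>Dividing \<open>W\<close> by \<open>l\<close> brings the spectral radius below 1, where
  the Jordan normal form bounds all powers by one constant; multiplying back by \<open>l ^ k\<close>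
  undoes the scaling.\<close>

lemma pow_entries_bound:
  assumes W: "W \<in> carrier_mat N N" and N: "0 < N" and l: "rho W < l"
  shows "\<exists>c. \<forall>k. \<forall>i<N. \<forall>j<N. \<bar>(W ^\<^sub>m k) $$ (i,j)\<bar> \<le> c * l ^ k"
proof -
  let ?C = "map_mat complex_of_real W"
  let ?s = "complex_of_real (1 / l)"
  have lpos: "0 < l" using l rho_nonneg[OF W N] by simp
  have C: "?C \<in> carrier_mat N N" using W by simp
  have sC: "?s \<cdot>\<^sub>m ?C \<in> carrier_mat N N" using C by simp
  have "spectral_radius (?s \<cdot>\<^sub>m ?C) \<le> (1 / l) * rho W"
    using spectral_radius_smult_le[OF C N, of ?s] lpos W by (simp add: rho_def norm_divide)
  also have "\<dots> < 1" using l lpos by simp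
  finally obtain c where c: "\<And>k. norm_bound ((?s \<cdot>\<^sub>m ?C) ^\<^sub>m k) c"
    using spectral_radius_jnf_norm_bound_less_1_upper_triangular[OF sC] by blast
  have "\<bar>(W ^\<^sub>m k) $$ (i,j)\<bar> \<le> c * l ^ k" if ij: "i < N" "j < N" for k i j
  proof -
    have Wk: "W ^\<^sub>m k \<in> carrier_mat N N" using W by simp
    have "(?s \<cdot>\<^sub>m ?C) ^\<^sub>m k = ?s ^ k \<cdot>\<^sub>m map_mat complex_of_real (W ^\<^sub>m k)"
      using pow_smult_mat[OF C] of_real_hom.mat_hom_pow[OF W, where ?'a = complex] by simp
    then have "norm_bound (?s ^ k \<cdot>\<^sub>m map_mat complex_of_real (W ^\<^sub>m k)) c" using c[of k] by simp
    then have "cmod (?s ^ k * of_real ((W ^\<^sub>m k) $$ (i,j))) \<le> c"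
      using carrier_matD[OF Wk] ij unfolding norm_bound_def by (simp del: pow_mat_dim)
    then show ?thesis using lpos by (simp add: norm_mult norm_power norm_divide field_simps)
  qed
  then show ?thesis by blast
qed

text \<open>Iterating the hypothesis gives \<open>W\<^sup>k z \<le> l\<^sup>k z\<close>, and \<open>W\<^sup>k / l\<^sup>k\<close> tends to 0.\<close>

lemma supersolution_nonneg:
  assumes W: "W \<in> carrier_mat N N" and N: "0 < N" and nn: "nonneg_mat W"
    and l: "rho W < l" and z: "z \<in> carrier_vec N" and sup: "W *\<^sub>v z \<le> l \<cdot>\<^sub>v z"
  shows "0\<^sub>v N \<le> z"
proof -
  \<comment> \<open>An intermediate rate leaves room: powers of \<open>W\<close> grow at most like
    \<open>l' ^ k\<close>, so after division by \<open>l ^ k\<close> the bound tends to 0.\<close>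
  obtain l' where l': "rho W < l'" "l' < l" using dense[OF l] by blast
  have l'pos: "0 < l'" and lpos: "0 < l" using l' rho_nonneg[OF W N] by auto
  obtain c where c: "\<And>k i j. i < N \<Longrightarrow> j < N \<Longrightarrow> \<bar>(W ^\<^sub>m k) $$ (i,j)\<bar> \<le> c * l' ^ k"
    using pow_entries_bound[OF W N l'(1)] by blast
  have iter: "W ^\<^sub>m k *\<^sub>v z \<le> l ^ k \<cdot>\<^sub>v z" for k
  proof (induction k)
    case 0
    then show ?case using W z by simp
  next
    case (Suc k)
    have Wk: "W ^\<^sub>m k \<in> carrier_mat N N" using W by simp
    have Wkz: "W ^\<^sub>m k *\<^sub>v z \<in> carrier_vec N" using Wk z by simp
    have "W ^\<^sub>m Suc k *\<^sub>v z = W *\<^sub>v (W ^\<^sub>m k *\<^sub>v z)"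
      unfolding pow_mat_Suc_left[OF W] using assoc_mult_mat_vec[OF W Wk z] .
    also have "\<dots> \<le> W *\<^sub>v (l ^ k \<cdot>\<^sub>v z)"
      using nonneg_mult_vec_mono[OF nn W Wkz _ Suc] z by simp
    also have "\<dots> = l ^ k \<cdot>\<^sub>v (W *\<^sub>v z)" using mult_mat_vec[OF W z] by simp
    also have "\<dots> \<le> l ^ Suc k \<cdot>\<^sub>v z"
      using sup lpos W z by (auto simp: less_eq_vec_def mult.assoc mult.left_commute[of l] intro!: mult_left_mono)
    finally show ?case .
  qed
  have "0 \<le> z $ i" if i: "i < N" for i
  proof -
    define K where "K = c * (\<Sum>j<N. \<bar>z $ j\<bar>)"
    have "- (K * (l' / l) ^ k) \<le> z $ i" for k
    proof -
      have Wk: "W ^\<^sub>m k \<in> carrier_mat N N" using W by simp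
      have "\<bar>(W ^\<^sub>m k *\<^sub>v z) $ i\<bar> \<le> (\<Sum>j<N. (c * l' ^ k) * \<bar>z $ j\<bar>)"
        unfolding nonneg_mat_mult_vec_index[OF Wk z i]
        by (intro order_trans[OF sum_abs] sum_mono) (auto simp: abs_mult i c intro!: mult_right_mono)
      also have "\<dots> = K * l' ^ k" by (simp add: K_def sum_distrib_left sum_distrib_right mult_ac)
      finally have "- (K * l' ^ k) \<le> l ^ k * z $ i"
        using iter[of k] i z by (auto simp: less_eq_vec_def)
      then show ?thesis using lpos by (simp add: power_divide field_simps)
    qed
    moreover have "(\<lambda>k. - (K * (l' / l) ^ k)) \<longlonglongrightarrow> - (K * 0)"
      using l'pos l' lpos by (intro tendsto_intros LIMSEQ_realpow_zero) auto
    ultimately show ?thesis using LIMSEQ_le_const2 by fastforce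
  qed
  then show ?thesis using z by (auto simp: less_eq_vec_def)
qed

text \<open>A kernel vector \<open>z\<close> of \<open>l - W\<close> and its negative both meet the
  hypotheses of \<open>supersolution_nonneg\<close>, so \<open>z\<close> is zero and
  \<open>l - W\<close> is invertible. The solution for \<open>w\<close> is itself a supersolution,
  hence nonnegative.\<close>

lemma resolvent_solution:
  assumes W: "W \<in> carrier_mat N N" and N: "0 < N" and nn: "nonneg_mat W"
    and l: "rho W < l" and w: "w \<in> carrier_vec N" and w0: "0\<^sub>v N \<le> w"
  shows "\<exists>z \<in> carrier_vec N. 0\<^sub>v N \<le> z \<and> l \<cdot>\<^sub>v z = W *\<^sub>v z + w"
proof -
  define L where "L = l \<cdot>\<^sub>m 1\<^sub>m N - W"
  have L: "L \<in> carrier_mat N N" using W by (simp add: L_def minus_carrier_mat)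
  have Lz: "(L *\<^sub>v z) $ i = l * z $ i - (W *\<^sub>v z) $ i" if "z \<in> carrier_vec N" "i < N" for z i
  proof -
    have "L *\<^sub>v z = (l \<cdot>\<^sub>m 1\<^sub>m N) *\<^sub>v z - W *\<^sub>v z"
      unfolding L_def using W that by (intro minus_mult_distrib_mat_vec[of _ N N]) auto
    moreover have "((l \<cdot>\<^sub>m 1\<^sub>m N) *\<^sub>v z) $ i = l * z $ i" using that by simp
    ultimately show ?thesis using W that by simp
  qed
  have "det L \<noteq> 0"
  proof
    assume "det L = 0"
    then obtain z where z: "z \<in> carrier_vec N" "z \<noteq> 0\<^sub>v N" "L *\<^sub>v z = 0\<^sub>v N"
      using det_0_iff_vec_prod_zero[OF L] by blast
    have eq: "(W *\<^sub>v z) $ i = l * z $ i" if "i < N" for i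
      using Lz[OF z(1) that] z that by simp
    then have "W *\<^sub>v z = l \<cdot>\<^sub>v z" using W z by (intro eq_vecI) auto
    moreover from this have "W *\<^sub>v (- z) = l \<cdot>\<^sub>v (- z)" using W z
      by (intro eq_vecI) (auto simp: uminus_scalar_prod[symmetric] vec_eq_iff)
    ultimately have "0\<^sub>v N \<le> z" "0\<^sub>v N \<le> - z"
      using supersolution_nonneg[OF W N nn l] z by auto
    then have "z = 0\<^sub>v N" using z by (intro eq_vecI) (force simp: less_eq_vec_def)+
    then show False using z by simp
  qed
  then obtain B where B: "B \<in> carrier_mat N N" "L * B = 1\<^sub>m N"
    using det_non_zero_imp_unit[OF L] by (auto simp: Units_def ring_mat_def)
  define z where "z = B *\<^sub>v w"
  have z: "z \<in> carrier_vec N" using B w by (simp add: z_def)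
  have "L *\<^sub>v z = w" unfolding z_def using assoc_mult_mat_vec[OF L B(1) w] B w by simp
  then have eq: "l \<cdot>\<^sub>v z = W *\<^sub>v z + w"
    using Lz[OF z] z w W by (intro eq_vecI) (auto simp: algebra_simps)
  have "W *\<^sub>v z \<le> l \<cdot>\<^sub>v z" unfolding eq using w0 w W by (auto simp: less_eq_vec_def)
  from supersolution_nonneg[OF W N nn l z this] show ?thesis using z eq by blast
qed

lemma zero_mat_mult_vec [simp]:
  fixes x :: "'a :: semiring_0 vec"
  shows "x \<in> carrier_vec n \<Longrightarrow> 0\<^sub>m m n *\<^sub>v x = 0\<^sub>v m"
  by (intro eq_vecI) auto

lemma uminus_mult_mat_vec_index:
  fixes B :: "'a :: ring mat"
  assumes "B \<in> carrier_mat m n" "x \<in> carrier_vec n" "i < m"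
  shows "((- B) *\<^sub>v x) $ i = - ((B *\<^sub>v x) $ i)"
  using assms by (simp add: scalar_prod_def sum_negf)

section \<open>Companion block matrices\<close>

text \<open>The one-step form of the recursion in which the next iterate is \<open>M\<close> times
  the current plus \<open>K\<close> times the previous one; \<open>iter_mat\<close> has this
  shape.\<close>

abbreviation companion :: "nat \<Rightarrow> real mat \<Rightarrow> real mat \<Rightarrow> real mat" where
  "companion n M K \<equiv> four_block_mat M K (1\<^sub>m n) (0\<^sub>m n n)"

context
  fixes M K :: "real mat" and n :: nat
  assumes M: "M \<in> carrier_mat n n" and K: "K \<in> carrier_mat n n"
begin

lemma companion_mult_vec:
  assumes "x \<in> carrier_vec n" and "y \<in> carrier_vec n"
  shows "companion n M K *\<^sub>v (x @\<^sub>v y) = (M *\<^sub>v x + K *\<^sub>v y) @\<^sub>v x"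
  using four_block_mat_mult_vec[OF M K one_carrier_mat zero_carrier_mat assms] assms by simp

lemma companion_carrier: "companion n M K \<in> carrier_mat (n + n) (n + n)"
  using M K by simp

context
  assumes n: "0 < n" and Mnn: "nonneg_mat M" and Knn: "nonneg_mat K"
begin

lemma nonneg_companion: "nonneg_mat (companion n M K)"
  using M K Mnn Knn by (auto simp: nonneg_mat_def)

text \<open>The test vector is \<open>x\<close> stacked on \<open>x / l\<close>: its lower block
  satisfies the eigenvalue equation for \<open>l\<close> exactly, and the upper block is the
  hypothesis \<open>sup\<close>.\<close>

lemma rho_companion_le:
  assumes x: "x \<in> carrier_vec n" and pos: "\<And>i. i < n \<Longrightarrow> 0 < x $ i" and l: "0 < l"
    and sup: "\<And>i. i < n \<Longrightarrow> (M *\<^sub>v x) $ i + (K *\<^sub>v x) $ i / l \<le> l * x $ i"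
  shows "rho (companion n M K) \<le> l"
proof (rule rho_le_of_supersolution[OF companion_carrier _ nonneg_companion])
  let ?y = "(1 / l) \<cdot>\<^sub>v x"
  have y: "?y \<in> carrier_vec n" using x by simp
  show "x @\<^sub>v ?y \<in> carrier_vec (n + n)" using x by simp
  show "0 < (x @\<^sub>v ?y) $ i" if "i < n + n" for i
    using that x pos l by auto
  have "K *\<^sub>v ?y = (1 / l) \<cdot>\<^sub>v (K *\<^sub>v x)" using mult_mat_vec[OF K x] .
  then show "companion n M K *\<^sub>v (x @\<^sub>v ?y) \<le> l \<cdot>\<^sub>v (x @\<^sub>v ?y)"
    unfolding companion_mult_vec[OF x y] using x M K l sup
    by (auto simp: less_eq_vec_def)
qed (use n in simp)

text \<open>The strict inequalities are the case \<open>l = 1\<close> of the hypothesis of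
  \<open>rho_companion_le\<close>. By continuity they survive for \<open>l\<close> slightly below 1,
  with one \<open>l\<close> serving all of the finitely many indices.\<close>

lemma rho_companion_less_1:
  assumes x: "x \<in> carrier_vec n" and pos: "\<And>i. i < n \<Longrightarrow> 0 < x $ i"
    and sub: "\<And>i. i < n \<Longrightarrow> (M *\<^sub>v x) $ i + (K *\<^sub>v x) $ i < x $ i"
  shows "rho (companion n M K) < 1"
proof -
  have "\<forall>\<^sub>F l in at_left 1. (M *\<^sub>v x) $ i + (K *\<^sub>v x) $ i / l < l * x $ i" if i: "i < n" for i
  proof -
    have "((\<lambda>l. l * x $ i - ((M *\<^sub>v x) $ i + (K *\<^sub>v x) $ i / l)) \<longlongrightarrow>
        1 * x $ i - ((M *\<^sub>v x) $ i + (K *\<^sub>v x) $ i / 1)) (at_left 1)"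
      by (intro tendsto_intros) auto
    then have "\<forall>\<^sub>F l in at_left 1. 0 < l * x $ i - ((M *\<^sub>v x) $ i + (K *\<^sub>v x) $ i / l)"
      by (rule order_tendstoD) (use sub[OF i] in simp)
    then show ?thesis by eventually_elim simp
  qed
  then have "\<forall>\<^sub>F l in at_left 1. \<forall>i\<in>{..<n}. (M *\<^sub>v x) $ i + (K *\<^sub>v x) $ i / l < l * x $ i"
    by (intro eventually_ball_finite) auto
  moreover have "\<forall>\<^sub>F l in at_left (1::real). l \<in> {0<..<1}"
    by (intro eventually_at_leftI[of 0]) auto
  ultimately have "\<forall>\<^sub>F l in at_left 1. l \<in> {0<..<1} \<and>
      (\<forall>i\<in>{..<n}. (M *\<^sub>v x) $ i + (K *\<^sub>v x) $ i / l < l * x $ i)"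
    by eventually_elim simp
  from eventually_happens'[OF trivial_limit_at_left_real this]
  obtain l where l: "0 < l" "l < 1"
    and "\<And>i. i < n \<Longrightarrow> (M *\<^sub>v x) $ i + (K *\<^sub>v x) $ i / l < l * x $ i"
    by auto
  then have "rho (companion n M K) \<le> l"
    using x pos by (intro rho_companion_le) (auto intro: less_imp_le)
  then show ?thesis using l by simp
qed

text \<open>The resolvent equation is solved with right-hand side \<open>w\<close> stacked on 0; the
  zero block forces the lower half of the solution to be \<open>x / l\<close>, leaving an equation
  in \<open>x\<close> alone.\<close>

lemma companion_resolvent:
  assumes l: "rho (companion n M K) < l" and w: "w \<in> carrier_vec n" "0\<^sub>v n \<le> w"
  shows "\<exists>x \<in> carrier_vec n. 0\<^sub>v n \<le> x \<and>
    (\<forall>i<n. l * x $ i = (M *\<^sub>v x) $ i + (K *\<^sub>v x) $ i / l + w $ i)"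
proof -
  have nn: "0 < n + n" using n by simp
  have lpos: "0 < l" using l rho_nonneg[OF companion_carrier nn] by simp
  have "w @\<^sub>v 0\<^sub>v n \<in> carrier_vec (n + n)" "0\<^sub>v (n + n) \<le> w @\<^sub>v 0\<^sub>v n"
    using w by (auto simp: less_eq_vec_def)
  from resolvent_solution[OF companion_carrier nn nonneg_companion l this]
  obtain z where z: "z \<in> carrier_vec (n + n)" "0\<^sub>v (n + n) \<le> z"
    and eqz: "l \<cdot>\<^sub>v z = companion n M K *\<^sub>v z + (w @\<^sub>v 0\<^sub>v n)" by blast
  define x y where "x = vec_first z n" and "y = vec_last z n"
  have xy: "x \<in> carrier_vec n" "y \<in> carrier_vec n" "z = x @\<^sub>v y"
    using z by (auto simp: x_def y_def)
  have eq: "l \<cdot>\<^sub>v (x @\<^sub>v y) = ((M *\<^sub>v x + K *\<^sub>v y) @\<^sub>v x) + (w @\<^sub>v 0\<^sub>v n)"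
    using eqz xy companion_mult_vec by simp
  have ub: "l * x $ i = (M *\<^sub>v x) $ i + (K *\<^sub>v y) $ i + w $ i" if "i < n" for i
    using arg_cong[OF eq, of "\<lambda>v. v $ i"] that xy M K w by simp
  have "l * y $ i = x $ i" if "i < n" for i
    using arg_cong[OF eq, of "\<lambda>v. v $ (n + i)"] that xy M K w by simp
  then have "y = (1 / l) \<cdot>\<^sub>v x" using xy lpos by (intro eq_vecI) (auto simp: field_simps)
  then have "K *\<^sub>v y = (1 / l) \<cdot>\<^sub>v (K *\<^sub>v x)" using mult_mat_vec[OF K xy(1)] by simp
  then have "\<forall>i<n. l * x $ i = (M *\<^sub>v x) $ i + (K *\<^sub>v x) $ i / l + w $ i"
    using ub K by simp
  moreover have "0\<^sub>v n \<le> x"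
  proof -
    have "0\<^sub>v (n + n) = 0\<^sub>v n @\<^sub>v (0\<^sub>v n :: real vec)" by (intro eq_vecI) auto
    then show ?thesis using z(2) xy append_vec_le[of "0\<^sub>v n" n x "0\<^sub>v n" y] by simp
  qed
  ultimately show ?thesis using xy by blast
qed

end

end

section \<open>Proper double splittings\<close>

lemma pds_carrier:
  assumes A: "A \<in> carrier_mat m n" and ds: "proper_double_splitting A P R S"
  shows "P \<in> carrier_mat m n" "R \<in> carrier_mat m n" "S \<in> carrier_mat m n"
    "mp_inverse P \<in> carrier_mat n m"
    "mp_inverse P * R \<in> carrier_mat n n" "- (mp_inverse P * S) \<in> carrier_mat n n"
proof -
  show P: "P \<in> carrier_mat m n" and "R \<in> carrier_mat m n" and "S \<in> carrier_mat m n"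
    using ds A by (auto simp: proper_double_splitting_def)
  show "mp_inverse P \<in> carrier_mat n m" using mp_inverse(1)[OF P] .
  then show "mp_inverse P * R \<in> carrier_mat n n" "- (mp_inverse P * S) \<in> carrier_mat n n"
    using \<open>R \<in> _\<close> \<open>S \<in> _\<close> by auto
qed

lemma pds_mult_vec:
  assumes A: "A \<in> carrier_mat m n" and ds: "proper_double_splitting A P R S"
    and x: "x \<in> carrier_vec n"
  shows "A *\<^sub>v x = P *\<^sub>v x - (R *\<^sub>v x - S *\<^sub>v x)"
proof -
  note c = pds_carrier[OF A ds]
  have "A *\<^sub>v x = (P - R + S) *\<^sub>v x" using ds by (simp add: proper_double_splitting_def)
  also have "\<dots> = (P *\<^sub>v x - R *\<^sub>v x) + S *\<^sub>v x"
    using c x by (subst add_mult_distrib_mat_vec[of _ m n]) (auto simp: minus_mult_distrib_mat_vec[of _ m n] minus_carrier_mat)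
  finally show ?thesis using c x by (auto intro!: eq_vecI)
qed

text \<open>Equal null spaces give \<open>mp_inverse P * P = mp_inverse A * A\<close>, and
  \<open>R - S = P - A\<close>. The first term on the right is common to all splittings of
  \<open>A\<close>, so comparing two of them reduces to comparing their \<open>mp_inverse P\<close>
  on \<open>A *\<^sub>v x\<close>.\<close>

lemma pds_iteration_identity:
  assumes A: "A \<in> carrier_mat m n" and ds: "proper_double_splitting A P R S"
    and x: "x \<in> carrier_vec n" and i: "i < n"
  shows "((mp_inverse P * R) *\<^sub>v x) $ i + ((- (mp_inverse P * S)) *\<^sub>v x) $ i =
    (mp_inverse A *\<^sub>v (A *\<^sub>v x)) $ i - (mp_inverse P *\<^sub>v (A *\<^sub>v x)) $ i"
proof -
  note c = pds_carrier[OF A ds]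
  have Ai: "mp_inverse A \<in> carrier_mat n m" using mp_inverse(1)[OF A] .
  have nl: "null_mat A = null_mat P" using ds unfolding proper_double_splitting_def by blast
  have v: "P *\<^sub>v x \<in> carrier_vec m" "R *\<^sub>v x \<in> carrier_vec m" "S *\<^sub>v x \<in> carrier_vec m"
    using c x by auto
  have "mp_inverse P *\<^sub>v (P *\<^sub>v x) = mp_inverse A *\<^sub>v (A *\<^sub>v x)"
    using mp_inverse_null_eq[OF A c(1) nl] assoc_mult_mat_vec[OF c(4,1) x] assoc_mult_mat_vec[OF Ai A x]
    by simp
  moreover have "mp_inverse P *\<^sub>v (A *\<^sub>v x) =
      mp_inverse P *\<^sub>v (P *\<^sub>v x) - (mp_inverse P *\<^sub>v (R *\<^sub>v x) - mp_inverse P *\<^sub>v (S *\<^sub>v x))"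
    unfolding pds_mult_vec[OF A ds x] using v c(4)
    by (simp add: mult_minus_distrib_mat_vec[OF c(4)])
  moreover have "((- (mp_inverse P * S)) *\<^sub>v x) $ i = - ((mp_inverse P *\<^sub>v (S *\<^sub>v x)) $ i)"
    using uminus_mult_mat_vec_index[of "mp_inverse P * S" n n x i] c x i
      assoc_mult_mat_vec[OF c(4,3) x] by simp
  ultimately show ?thesis
    using c(4) i assoc_mult_mat_vec[OF c(4,2) x] by simp
qed

text \<open>Since \<open>e\<close> lies in the range of \<open>A\<close>, the vector \<open>x = A\<^sup>\<dagger>e\<close> satisfies \<open>x - P\<^sup>\<dagger>(R - S)x = P\<^sup>\<dagger>e\<close>, which is positive because
  \<open>P\<^sup>\<dagger>\<close> is nonnegative without zero rows.\<close>

lemma rho_iter_mat_less_1: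
  assumes A: "A \<in> carrier_mat m n" and n: "0 < n" and e: "vec m (\<lambda>_. 1) \<in> range_mat A"
    and Ann: "nonneg_mat (mp_inverse A)" and ds: "weak_regular_pds A P R S"
    and pos: "\<And>i. i < n \<Longrightarrow> 0 < (mp_inverse P *\<^sub>v vec m (\<lambda>_. 1)) $ i"
  shows "rho (iter_mat n P R S) < 1"
proof -
  have pds: "proper_double_splitting A P R S"
    and nn: "nonneg_mat (mp_inverse P * R)" "nonneg_mat (- (mp_inverse P * S))"
    using ds by (auto simp: weak_regular_pds_def)
  note c = pds_carrier[OF A pds]
  let ?e = "vec m (\<lambda>_. 1) :: real vec"
  have ec: "?e \<in> carrier_vec m" by simp
  have Ai: "mp_inverse A \<in> carrier_mat n m" using mp_inverse(1)[OF A] .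
  define x where "x = mp_inverse A *\<^sub>v ?e"
  have x: "x \<in> carrier_vec n" using Ai by (simp add: x_def)
  obtain y where y: "y \<in> carrier_vec n" "?e = A *\<^sub>v y" using e A by (auto simp: range_mat_def)
  have AAi: "A * mp_inverse A \<in> carrier_mat m m" using A Ai by auto
  have "A *\<^sub>v x = (A * mp_inverse A) *\<^sub>v (A *\<^sub>v y)"
    unfolding x_def using assoc_mult_mat_vec[OF A Ai ec] y by simp
  \<comment> \<open>This is where \<open>e\<close> in the range of \<open>A\<close> enters:
    \<open>A * mp_inverse A\<close> fixes that range.\<close>
  also have "\<dots> = ?e" using assoc_mult_mat_vec[OF AAi A y(1)] mp_inverse(2)[OF A] y by simp
  finally have Ax: "A *\<^sub>v x = ?e" .
  have fix_eq: "((mp_inverse P * R) *\<^sub>v x) $ i + ((- (mp_inverse P * S)) *\<^sub>v x) $ i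
      = x $ i - (mp_inverse P *\<^sub>v ?e) $ i" if "i < n" for i
    using pds_iteration_identity[OF A pds x that] Ax by (simp add: x_def)
  have x0: "0\<^sub>v n \<le> x"
    unfolding x_def by (rule nonneg_mult_vec[OF Ann Ai ec]) (simp add: less_eq_vec_def)
  have xpos: "0 < x $ i" if "i < n" for i
  proof -
    have "0 \<le> ((mp_inverse P * R) *\<^sub>v x) $ i" "0 \<le> ((- (mp_inverse P * S)) *\<^sub>v x) $ i"
      using nonneg_mult_vec[OF nn(1) c(5) x x0] nonneg_mult_vec[OF nn(2) c(6) x x0] that c(5,6)
      by (auto simp: less_eq_vec_def)
    then show ?thesis using fix_eq[OF that] pos[OF that] by linarith
  qed
  have "((mp_inverse P * R) *\<^sub>v x) $ i + ((- (mp_inverse P * S)) *\<^sub>v x) $ i < x $ i" if "i < n" for i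
    using fix_eq[OF that] pos[OF that] by linarith
  then show ?thesis
    unfolding iter_mat_def using rho_companion_less_1[OF c(5,6) n nn x xpos] by blast
qed

lemma regular_imp_weak_regular_pds:
  assumes A: "A \<in> carrier_mat m n" and ds: "regular_pds A P R S"
  shows "weak_regular_pds A P R S"
proof -
  have pds: "proper_double_splitting A P R S" and P: "nonneg_mat (mp_inverse P)"
    and R: "nonneg_mat R" and S: "nonneg_mat (- S)"
    using ds by (auto simp: regular_pds_def)
  note c = pds_carrier[OF A pds]
  have prod: "nonneg_mat (B * C)"
    if "nonneg_mat B" "nonneg_mat C" "B \<in> carrier_mat n m" "C \<in> carrier_mat m n" for B C
    using that by (auto simp: nonneg_mat_def scalar_prod_def intro!: sum_nonneg mult_nonneg_nonneg)
  have "- (mp_inverse P * S) = mp_inverse P * (- S)"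
    using c by (auto intro!: eq_matI)
  then show ?thesis
    using pds P prod[OF P R] prod[OF P S] c by (auto simp: weak_regular_pds_def)
qed

section \<open>Entrywise estimates and the comparison of the two spectral radii\<close>

lemma mat_ge_mult_vec:
  assumes ge: "mat_ge B C" and B: "B \<in> carrier_mat m n" and C: "C \<in> carrier_mat m n"
    and x: "x \<in> carrier_vec n" "0\<^sub>v n \<le> x"
    and i: "i < m"
  shows "(C *\<^sub>v x) $ i \<le> (B *\<^sub>v x) $ i"
proof -
  have "0\<^sub>v m \<le> (B - C) *\<^sub>v x"
    using ge B C x by (intro nonneg_mult_vec) (auto simp: mat_ge_def minus_carrier_mat)
  then show ?thesis
    using minus_mult_distrib_mat_vec[OF B C x(1)] B C i by (auto simp: less_eq_vec_def)
qed

lemma nonneg_row_sum_pos: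
  assumes B: "B \<in> carrier_mat n m" "nonneg_mat B" and i: "i < n"
    and nz: "\<exists>j<m. B $$ (i,j) \<noteq> 0"
  shows "0 < (B *\<^sub>v vec m (\<lambda>_. 1)) $ i"
proof -
  obtain j where j: "j < m" "B $$ (i,j) \<noteq> 0" using nz by blast
  have nn: "0 \<le> B $$ (i,k)" if "k < m" for k using B i that by (simp add: nonneg_mat_def)
  have "0 < B $$ (i,j)" using nn[OF j(1)] j(2) by simp
  then have "0 < (\<Sum>k<m. B $$ (i,k))"
    using j(1) nn by (intro sum_pos2[of _ j]) auto
  then show ?thesis using nonneg_mat_mult_vec_index[OF B(1) _ i, of "vec m (\<lambda>_. 1)"] by simp
qed

text \<open>Multiply the equation for \<open>x\<close> by \<open>P\<close>; with \<open>Q = PP\<^sup>\<dagger> = AA\<^sup>\<dagger>\<close> it gives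
  \<open>Ax = (1/l - 1) QRx - (1/l\<^sup>2 - 1) QSx + (1/l) Qw\<close>, in which every term is nonnegative.\<close>

lemma regular_pds_resolvent_image_nonneg:
  assumes A: "A \<in> carrier_mat m n" and ds: "regular_pds A P R S"
    and Q: "nonneg_mat (P * mp_inverse P)" and l: "0 < l" "l < 1"
    and x: "x \<in> carrier_vec n" "0\<^sub>v n \<le> x" and w: "w \<in> carrier_vec m" "0\<^sub>v m \<le> w"
    and eq: "\<And>i. i < n \<Longrightarrow> l * x $ i = ((mp_inverse P * R) *\<^sub>v x) $ i
        + ((- (mp_inverse P * S)) *\<^sub>v x) $ i / l + (mp_inverse P *\<^sub>v w) $ i"
  shows "0\<^sub>v m \<le> A *\<^sub>v x"
proof -
  have pds: "proper_double_splitting A P R S" and R: "nonneg_mat R" and S: "nonneg_mat (- S)"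
    using ds by (auto simp: regular_pds_def)
  note c = pds_carrier[OF A pds]
  have Sc: "- S \<in> carrier_mat m n" using c by simp
  let ?P = "mp_inverse P" and ?Q = "P * mp_inverse P"
  define r s where "r = R *\<^sub>v x" and "s = (- S) *\<^sub>v x"
  have r: "r \<in> carrier_vec m" "0\<^sub>v m \<le> r" and s: "s \<in> carrier_vec m" "0\<^sub>v m \<le> s"
    using nonneg_mult_vec[OF R c(2) x] nonneg_mult_vec[OF S Sc x] c Sc x by (auto simp: r_def s_def)
  have Qc: "?Q \<in> carrier_mat m m" using c by auto
  have QB: "?Q *\<^sub>v v = P *\<^sub>v (?P *\<^sub>v v)" if "v \<in> carrier_vec m" for v
    using assoc_mult_mat_vec[OF c(1,4) that] .
  have PS: "(- (?P * S)) *\<^sub>v x = ?P *\<^sub>v s"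
  proof -
    have "- (?P * S) = ?P * (- S)" using c by (auto intro!: eq_matI)
    then show ?thesis using assoc_mult_mat_vec[OF c(4) Sc x(1)] by (simp add: s_def)
  qed
  have PR: "(?P * R) *\<^sub>v x = ?P *\<^sub>v r" using assoc_mult_mat_vec[OF c(4,2) x(1)] by (simp add: r_def)
  \<comment> \<open>Collects the right-hand side of \<open>eq\<close> under one factor:
    \<open>l\<close> times \<open>x\<close> is \<open>mp_inverse P\<close> applied to
    \<open>u\<close>, and multiplying by \<open>P\<close> gives
    \<open>?Q *\<^sub>v u\<close>.\<close>
  define u where "u = r + (1 / l) \<cdot>\<^sub>v s + w"
  have u: "u \<in> carrier_vec m" using r s w by (simp add: u_def)
  have lin: "(B *\<^sub>v u) $ i = (B *\<^sub>v r) $ i + (B *\<^sub>v s) $ i / l + (B *\<^sub>v w) $ i"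
    if B: "B \<in> carrier_mat k m" and i: "i < k" for B :: "real mat" and i k
    using B i r s w mult_add_distrib_mat_vec[OF B, of "r + (1 / l) \<cdot>\<^sub>v s" w]
      mult_add_distrib_mat_vec[OF B, of r "(1 / l) \<cdot>\<^sub>v s"] mult_mat_vec[OF B s(1), of "1 / l"]
    by (simp add: u_def)
  have "l \<cdot>\<^sub>v x = ?P *\<^sub>v u"
    using x c(4) eq lin[OF c(4)] PR PS by (intro eq_vecI) auto
  then have lPx: "l \<cdot>\<^sub>v (P *\<^sub>v x) = ?Q *\<^sub>v u"
    using mult_mat_vec[OF c(1) x(1), of l] QB[OF u] by simp
  have Ax: "A *\<^sub>v x \<in> carrier_vec m" and Px: "P *\<^sub>v x \<in> carrier_vec m" using A c x by auto
  have rg: "range_mat A = range_mat P" using pds unfolding proper_double_splitting_def by blast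
  \<comment> \<open>Equal ranges identify \<open>?Q\<close> with \<open>A * mp_inverse A\<close>, so
    applying \<open>?Q\<close> to \<open>A *\<^sub>v x\<close> changes nothing but puts
    \<open>r\<close> and \<open>s\<close> under \<open>?Q\<close>, where signs are known.\<close>
  have "?Q *\<^sub>v (A *\<^sub>v x) = A *\<^sub>v x"
    using mp_inverse_range_eq[OF A c(1) rg] mp_inverse(2)[OF A] assoc_mult_mat_vec[OF Qc A x(1)]
    by simp
  moreover have "?Q *\<^sub>v (P *\<^sub>v x) = P *\<^sub>v x"
    using mp_inverse(2)[OF c(1)] assoc_mult_mat_vec[OF Qc c(1) x(1)] by simp
  moreover have "A *\<^sub>v x = P *\<^sub>v x - (r + s)"
    using pds_mult_vec[OF A pds x(1)] c x uminus_mult_mat_vec_index[OF c(3) x(1)]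
    by (intro eq_vecI) (auto simp: r_def s_def)
  ultimately have AQ: "A *\<^sub>v x = P *\<^sub>v x - (?Q *\<^sub>v r + ?Q *\<^sub>v s)"
    using mult_minus_distrib_mat_vec[OF Qc Px, of "r + s"] mult_add_distrib_mat_vec[OF Qc r(1) s(1)] r s
    by simp
  show ?thesis
    unfolding less_eq_vec_def
  proof (intro conjI allI impI)
    fix i assume "i < dim_vec (A *\<^sub>v x)"
    then have i: "i < m" using A by simp
    define a b d where "a = (?Q *\<^sub>v r) $ i" and "b = (?Q *\<^sub>v s) $ i" and "d = (?Q *\<^sub>v w) $ i"
    have nn: "0 \<le> a" "0 \<le> b" "0 \<le> d"
      using nonneg_mult_vec[OF Q Qc r] nonneg_mult_vec[OF Q Qc s] nonneg_mult_vec[OF Q Qc w] i Qc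
      by (auto simp: less_eq_vec_def a_def b_def d_def)
    have "l * (P *\<^sub>v x) $ i = a + b / l + d"
      using arg_cong[OF lPx, of "\<lambda>v. v $ i"] lin[OF Qc i] i c(1) by (simp add: a_def b_def d_def)
    \<comment> \<open>Here \<open>l < 1\<close> is used, and again below to drop the factor
      \<open>l\<close> in front of the nonnegative entry of \<open>P *\<^sub>v x\<close>.\<close>
    moreover have "b \<le> b / l" using nn l by (simp add: field_simps mult_left_le)
    ultimately have "a + b \<le> l * (P *\<^sub>v x) $ i" using nn by simp
    moreover from this have "0 \<le> (P *\<^sub>v x) $ i" using nn l by (smt (verit) mult_pos_neg)
    ultimately have "a + b \<le> (P *\<^sub>v x) $ i" using l by (smt (verit) mult_left_le_one_le)
    moreover have "(A *\<^sub>v x) $ i = (P *\<^sub>v x) $ i - (a + b)"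
      unfolding AQ using i c(1) Qc by (simp add: a_def b_def)
    ultimately show "0\<^sub>v m $ i \<le> (A *\<^sub>v x) $ i" using i by simp
  qed (use A in simp)
qed

theorem theorem3p5:
  fixes A P1 R1 S1 P2 R2 S2 :: "real mat" and m n :: nat
  assumes "0 < m" and "0 < n" and "A \<in> carrier_mat m n"
    and "vec m (\<lambda>_. 1) \<in> range_mat A"
    and "nonneg_mat (mp_inverse A)"
    and "weak_regular_pds A P1 R1 S1"
    and "regular_pds A P2 R2 S2"
    and "\<forall>i<n. \<exists>j<m. mp_inverse P2 $$ (i,j) \<noteq> 0"
    and "nonneg_mat (P2 * mp_inverse P2)"
    and "mat_ge (mp_inverse P1) (mp_inverse P2)"
    and "mat_ge (mp_inverse P1 * R1) (mp_inverse P2 * R2) \<or>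
         mat_ge (mp_inverse P1 * S1) (mp_inverse P2 * S2)"
  shows "rho (iter_mat n P1 R1 S1) \<le> rho (iter_mat n P2 R2 S2) \<and> rho (iter_mat n P2 R2 S2) < 1"
proof
  note A = assms(3) and n = assms(2) and reg2 = assms(7)
  have weak2: "weak_regular_pds A P2 R2 S2" using regular_imp_weak_regular_pds[OF A reg2] .
  have pds1: "proper_double_splitting A P1 R1 S1" and pds2: "proper_double_splitting A P2 R2 S2"
    and nn1: "nonneg_mat (mp_inverse P1 * R1)" "nonneg_mat (- (mp_inverse P1 * S1))"
    and nn2: "nonneg_mat (mp_inverse P2 * R2)" "nonneg_mat (- (mp_inverse P2 * S2))"
    and P2: "nonneg_mat (mp_inverse P2)"
    using assms(6) weak2 by (auto simp: weak_regular_pds_def)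
  note c1 = pds_carrier[OF A pds1] and c2 = pds_carrier[OF A pds2]
  let ?e = "vec m (\<lambda>_. 1) :: real vec"
  have e: "?e \<in> carrier_vec m" "0\<^sub>v m \<le> ?e" by (auto simp: less_eq_vec_def)
  have pos: "0 < (mp_inverse P2 *\<^sub>v ?e) $ i" if "i < n" for i
    using nonneg_row_sum_pos[OF c2(4) P2 that] assms(8) that by blast
  show less1: "rho (iter_mat n P2 R2 S2) < 1"
    using rho_iter_mat_less_1[OF A n assms(4,5) weak2 pos] .
  have W2: "companion n (mp_inverse P2 * R2) (- (mp_inverse P2 * S2)) \<in> carrier_mat (n + n) (n + n)"
    using companion_carrier[OF c2(5,6)] .
  have rho0: "0 \<le> rho (iter_mat n P2 R2 S2)"
    unfolding iter_mat_def using rho_nonneg[OF W2] n by simp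
  show "rho (iter_mat n P1 R1 S1) \<le> rho (iter_mat n P2 R2 S2)"
  proof (rule dense_ge_bounded[OF less1])
    fix l assume l: "rho (iter_mat n P2 R2 S2) < l" "l < 1"
    then have lpos: "0 < l" using rho0 by simp
    let ?w = "mp_inverse P2 *\<^sub>v ?e"
    have w: "?w \<in> carrier_vec n" "0\<^sub>v n \<le> ?w"
      using c2(4) pos by (auto simp: less_eq_vec_def less_imp_le)
    obtain x where x: "x \<in> carrier_vec n" "0\<^sub>v n \<le> x"
      and eq: "\<And>i. i < n \<Longrightarrow> l * x $ i = ((mp_inverse P2 * R2) *\<^sub>v x) $ i
        + ((- (mp_inverse P2 * S2)) *\<^sub>v x) $ i / l + ?w $ i"
      using companion_resolvent[OF c2(5,6) n nn2 l(1)[unfolded iter_mat_def] w] by blast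
    have xpos: "0 < x $ i" if "i < n" for i
    proof -
      have "0 \<le> ((mp_inverse P2 * R2) *\<^sub>v x) $ i" "0 \<le> ((- (mp_inverse P2 * S2)) *\<^sub>v x) $ i / l"
        using nonneg_mult_vec[OF nn2(1) c2(5) x] nonneg_mult_vec[OF nn2(2) c2(6) x] that c2(5,6) lpos
        by (auto simp: less_eq_vec_def)
      \<comment> \<open>The source term \<open>?w\<close> is positive in every coordinate, which a
        Perron vector alone would not guarantee for \<open>x\<close>.\<close>
      then have "0 < l * x $ i" using eq[OF that] pos[OF that] by linarith
      then show ?thesis using lpos by (simp add: zero_less_mult_iff)
    qed
    have Ax0: "0\<^sub>v m \<le> A *\<^sub>v x"
      using regular_pds_resolvent_image_nonneg[OF A reg2 assms(9) lpos l(2) x e eq] .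
    have Ax: "A *\<^sub>v x \<in> carrier_vec m" using A x by simp
    have "((mp_inverse P1 * R1) *\<^sub>v x) $ i + ((- (mp_inverse P1 * S1)) *\<^sub>v x) $ i / l \<le> l * x $ i"
      if i: "i < n" for i
    proof -
      define a1 b1 a2 b2 where ab: "a1 = ((mp_inverse P1 * R1) *\<^sub>v x) $ i"
        "b1 = ((- (mp_inverse P1 * S1)) *\<^sub>v x) $ i" "a2 = ((mp_inverse P2 * R2) *\<^sub>v x) $ i"
        "b2 = ((- (mp_inverse P2 * S2)) *\<^sub>v x) $ i"
      have "(mp_inverse P2 *\<^sub>v (A *\<^sub>v x)) $ i \<le> (mp_inverse P1 *\<^sub>v (A *\<^sub>v x)) $ i"
        using mat_ge_mult_vec[OF assms(10) c1(4) c2(4) Ax Ax0 i] .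
      \<comment> \<open>The common \<open>mp_inverse A\<close> terms cancel, and the larger inverse
        subtracts more.\<close>
      then have sum: "a1 + b1 \<le> a2 + b2"
        using pds_iteration_identity[OF A pds1 x(1) i] pds_iteration_identity[OF A pds2 x(1) i]
        by (simp add: ab)
      have PS: "mp_inverse P1 * S1 \<in> carrier_mat n n" "mp_inverse P2 * S2 \<in> carrier_mat n n"
        using c1 c2 by auto
      \<comment> \<open>Both alternatives lead here: (i) bounds \<open>a2\<close> by
        \<open>a1\<close>, which \<open>sum\<close> turns into the claim, while (ii) gives it
        directly after the sign change.\<close>
      have b: "b1 \<le> b2"
        using assms(11)
      proof
        assume "mat_ge (mp_inverse P1 * R1) (mp_inverse P2 * R2)"
        from mat_ge_mult_vec[OF this c1(5) c2(5) x i] have "a2 \<le> a1"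
          by (simp only: ab)
        then show ?thesis using sum by simp
      next
        assume "mat_ge (mp_inverse P1 * S1) (mp_inverse P2 * S2)"
        from mat_ge_mult_vec[OF this PS x i] show ?thesis
          unfolding ab uminus_mult_mat_vec_index[OF PS(1) x(1) i] uminus_mult_mat_vec_index[OF PS(2) x(1) i]
          by simp
      qed
      \<comment> \<open>Since \<open>1 / l\<close> exceeds 1 and \<open>b2 - b1\<close> is
        nonnegative, \<open>a1 - a2\<close> is at most \<open>b2 - b1\<close>, hence at most
        \<open>(b2 - b1) / l\<close>.\<close>
      have "(b2 - b1) * 1 \<le> (b2 - b1) * (1 / l)"
        using b lpos l(2) by (intro mult_left_mono) auto
      then have "a1 + b1 / l \<le> a2 + b2 / l" using sum by (simp add: field_simps diff_divide_distrib)
      also have "\<dots> \<le> l * x $ i" using eq[OF i] pos[OF i] by (simp add: ab)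
      finally show ?thesis by (simp add: ab)
    qed
    then show "rho (iter_mat n P1 R1 S1) \<le> l"
      unfolding iter_mat_def using rho_companion_le[OF c1(5,6) n nn1 x(1) xpos lpos] by blast
  qed
qed

end
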